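(* Let $L$ be a set and let $(X,\alpha)$ and $(Y,\beta)$ be $L$-labeled metric spaces. Suppose that for all finite subsets $L'\subseteq L$ we have $d^{L'}_{GH}(X,\alpha;Y,\beta)=0$. Suppose furthermore that $\alpha(L)\subseteq X$ is closed. Then $d^L_{GH}(X,\alpha;Y,\beta)=0$.
   Context: All metric spaces are assumed to be compact. Given a set $L$, an $L$-labeled metric space is a pair $(X,\alpha)$ where $X$ is a (compact) metric space and $\alpha\colon L\to X$ is an arbitrary map (a labeling). For $L$-labeled metric spaces $(X,\alpha)$, $(Y,\beta)$ and $t\ge 0$, a pseudometric $d\colon (X\sqcup Y)^2\to[0,\infty)$ on the disjoint union is called $(t,L)$-admissible if (1) $d|_{X\times X}=d_X$ and $d|_{Y\times Y}=d_Y$; (2) $d_H(X,Y)\le t$, where $d_H$ is the Hausdorff distance with respect to $d$; (3) $\sup_{\ell\in L}d(\alpha(\ell),\beta(\ell))\le t$ (with $\sup\varnothing=0$). The labeled Gromov-Hausdorff (LGH) distance is $$d_{GH}^L(X,\alpha;Y,\beta):=\inf\{t : \text{there exists a } (t,L)\text{-admissible pseudometric on } X\sqcup Y\}.$$ For $L'\subseteq L$, $d_{GH}^{L'}(X,\alpha;Y,\beta)$ denotes the LGH distance of the $L'$-labeled spaces obtained by restricting $\alpha$ and $\beta$ to $L'$. *)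

theory Defs
  imports "HOL-Analysis.Analysis"
begin

(* Spaces are carrier-based ('a metric), so that the empty space is included. *)

definition labeled_metric_space :: "'l set \<Rightarrow> 'a metric \<Rightarrow> ('l \<Rightarrow> 'a) \<Rightarrow> bool" where
  "labeled_metric_space L X \<alpha> \<longleftrightarrow> compact_space (mtopology_of X) \<and> \<alpha> \<in> L \<rightarrow> mspace X"

definition pseudometric_on :: "'a set \<Rightarrow> ('a \<Rightarrow> 'a \<Rightarrow> real) \<Rightarrow> bool" where
  "pseudometric_on S d \<longleftrightarrow>
     (\<forall>x\<in>S. \<forall>y\<in>S. 0 \<le> d x y) \<and>
     (\<forall>x\<in>S. d x x = 0) \<and>
     (\<forall>x\<in>S. \<forall>y\<in>S. d x y = d y x) \<and>
     (\<forall>x\<in>S. \<forall>y\<in>S. \<forall>z\<in>S. d x z \<le> d x y + d y z)"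

(* In ennreal an empty supremum is 0 and an empty infimum is infinity; hence two empty sets have
   distance 0, and an empty and a nonempty set have distance infinity. *)
definition hausdorff_dist :: "('a \<Rightarrow> 'a \<Rightarrow> real) \<Rightarrow> 'a set \<Rightarrow> 'a set \<Rightarrow> ennreal" where
  "hausdorff_dist d A B =
     max (SUP a\<in>A. INF b\<in>B. ennreal (d a b)) (SUP b\<in>B. INF a\<in>A. ennreal (d a b))"

definition admissible ::
  "real \<Rightarrow> 'l set \<Rightarrow> 'a metric \<Rightarrow> ('l \<Rightarrow> 'a) \<Rightarrow> 'b metric \<Rightarrow> ('l \<Rightarrow> 'b) \<Rightarrow>
     ('a + 'b \<Rightarrow> 'a + 'b \<Rightarrow> real) \<Rightarrow> bool" where
  "admissible t L X \<alpha> Y \<beta> d \<longleftrightarrow>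
     pseudometric_on (mspace X <+> mspace Y) d \<and>
     (\<forall>x\<in>mspace X. \<forall>x'\<in>mspace X. d (Inl x) (Inl x') = mdist X x x') \<and>
     (\<forall>y\<in>mspace Y. \<forall>y'\<in>mspace Y. d (Inr y) (Inr y') = mdist Y y y') \<and>
     hausdorff_dist d (Inl ` mspace X) (Inr ` mspace Y) \<le> ennreal t \<and>
     (SUP l\<in>L. ennreal (d (Inl (\<alpha> l)) (Inr (\<beta> l)))) \<le> ennreal t"

(* Only the values of the labelings on L matter, so for L' \<subseteq> L the term LGH_dist L' X \<alpha> Y \<beta>
   is the distance for the labelings restricted to L'.  The value is infinity when no t works,
   i.e. when exactly one of the two spaces is empty. *)
definition LGH_dist ::
  "'l set \<Rightarrow> 'a metric \<Rightarrow> ('l \<Rightarrow> 'a) \<Rightarrow> 'b metric \<Rightarrow> ('l \<Rightarrow> 'b) \<Rightarrow> ennreal" where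
  "LGH_dist L X \<alpha> Y \<beta> = Inf {ennreal t | t. 0 \<le> t \<and> (\<exists>d. admissible t L X \<alpha> Y \<beta> d)}"

end

theory Submission
  imports Defs
begin

text \<open>
  By total boundedness of \<open>X\<close> and \<open>Y\<close>, the pairs \<open>(\<alpha> l, \<beta> l)\<close> with \<open>l \<in> L\<close> have a finite
  \<open>e\<close>-net indexed by some \<open>L' \<subseteq> L\<close>. A pseudometric that is admissible for \<open>t\<close> and
  \<open>L'\<close> is then already admissible for \<open>t + 2 * e\<close> and \<open>L\<close>: go from \<open>\<alpha> l\<close> to
  \<open>\<alpha> m\<close>, \<open>\<beta> m\<close> and \<open>\<beta> l\<close> for a nearby label \<open>m \<in> L'\<close>.
\<close>

lemma compact_space_finite_net:
  assumes "compact_space (mtopology_of X)" "0 < e"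
  obtains N where "finite N" "N \<subseteq> mspace X" "\<And>x. x \<in> mspace X \<Longrightarrow> \<exists>a\<in>N. mdist X a x < e"
proof -
  interpret Metric_space "mspace X" "mdist X" by simp
  have "mtotally_bounded (mspace X)"
    using assms(1) compact_space_eq_mcomplete_mtotally_bounded by (simp add: mtopology_of_def)
  with assms(2) obtain N where "finite N" "N \<subseteq> mspace X" "mspace X \<subseteq> (\<Union>a\<in>N. mball a e)"
    unfolding mtotally_bounded_def by meson
  with that[of N] show thesis
    by (auto simp: subset_iff)
qed

text \<open>Centres of finite nets of \<open>X\<close> and \<open>Y\<close> need not carry labels.
  So each pair of centres is replaced by one label whose two images are close to it, and nets of
  radius \<open>e/2\<close> leave room for this replacement.\<close>

lemma finite_label_net:
  assumes "labeled_metric_space L X \<alpha>" "labeled_metric_space L Y \<beta>" "0 < e"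
  obtains L' where "finite L'" "L' \<subseteq> L"
    "\<And>l. l \<in> L \<Longrightarrow> \<exists>m\<in>L'. mdist X (\<alpha> l) (\<alpha> m) < e \<and> mdist Y (\<beta> l) (\<beta> m) < e"
proof -
  have X: "\<alpha> l \<in> mspace X" and Y: "\<beta> l \<in> mspace Y" if "l \<in> L" for l
    using assms that by (auto simp: labeled_metric_space_def)
  obtain A where A: "finite A" "A \<subseteq> mspace X"
    "\<And>x. x \<in> mspace X \<Longrightarrow> \<exists>a\<in>A. mdist X a x < e/2"
    using compact_space_finite_net[of X "e/2"] assms by (auto simp: labeled_metric_space_def)
  obtain B where B: "finite B" "B \<subseteq> mspace Y"
    "\<And>y. y \<in> mspace Y \<Longrightarrow> \<exists>b\<in>B. mdist Y b y < e/2"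
    using compact_space_finite_net[of Y "e/2"] assms by (auto simp: labeled_metric_space_def)
  define near where
    "near p l \<longleftrightarrow> l \<in> L \<and> mdist X (fst p) (\<alpha> l) < e/2 \<and> mdist Y (snd p) (\<beta> l) < e/2" for p l
  \<comment> \<open>Pairs of centres without a nearby label are dropped, so every choice made by
    \<open>SOME\<close> is a genuine label in \<open>L\<close>.\<close>
  define L' where "L' = (\<lambda>p. SOME l. near p l) ` {p \<in> A \<times> B. \<exists>l. near p l}"
  show thesis
  proof
    show "finite L'"
      using A(1) B(1) by (simp add: L'_def)
    show "L' \<subseteq> L"
      unfolding L'_def using someI_ex[of "near _"] by (fastforce simp: near_def)
    fix l assume l: "l \<in> L"
    obtain a b where ab: "a \<in> A" "b \<in> B" "near (a, b) l"
      using A(3)[OF X[OF l]] B(3)[OF Y[OF l]] l by (auto simp: near_def)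
    define m where "m = (SOME l. near (a, b) l)"
    have m: "near (a, b) m"
      unfolding m_def using ab(3) by (rule someI)
    have "m \<in> L'"
      unfolding L'_def m_def using ab by blast
    \<comment> \<open>\<open>l\<close> and \<open>m\<close> are near the same pair
      \<open>(a, b)\<close>, so in each space the path through the centre is shorter than
      \<open>e/2 + e/2\<close>.\<close>
    moreover have "mdist X (\<alpha> l) (\<alpha> m) < e"
      using mdist_triangle[of "\<alpha> l" X a "\<alpha> m"] mdist_commute[of X a "\<alpha> l"] ab m A(2) X
      by (fastforce simp: near_def)
    moreover have "mdist Y (\<beta> l) (\<beta> m) < e"
      using mdist_triangle[of "\<beta> l" Y b "\<beta> m"] mdist_commute[of Y b "\<beta> l"] ab m B(2) Y
      by (fastforce simp: near_def)
    ultimately show "\<exists>m\<in>L'. mdist X (\<alpha> l) (\<alpha> m) < e \<and> mdist Y (\<beta> l) (\<beta> m) < e"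
      by blast
  qed
qed

text \<open>The same \<open>d\<close> serves for both label sets: the Hausdorff condition does not
  mention labels and survives the larger bound, so only the label condition needs an
  argument.\<close>

lemma admissible_extend_labels:
  assumes d: "admissible t L' X \<alpha> Y \<beta> d" and "0 \<le> t" "0 \<le> e"
    and X: "\<alpha> \<in> L \<rightarrow> mspace X" and Y: "\<beta> \<in> L \<rightarrow> mspace Y" and "L' \<subseteq> L"
    and net: "\<And>l. l \<in> L \<Longrightarrow> \<exists>m\<in>L'. mdist X (\<alpha> l) (\<alpha> m) < e \<and> mdist Y (\<beta> l) (\<beta> m) < e"
  shows "admissible (t + 2 * e) L X \<alpha> Y \<beta> d"
proof -
  have label: "d (Inl (\<alpha> l)) (Inr (\<beta> l)) \<le> t + 2 * e" if l: "l \<in> L" for l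
  proof -
    obtain m where m: "m \<in> L'" "mdist X (\<alpha> l) (\<alpha> m) < e" "mdist Y (\<beta> l) (\<beta> m) < e"
      using net[OF l] by blast
    have mem: "\<alpha> l \<in> mspace X" "\<alpha> m \<in> mspace X" "\<beta> l \<in> mspace Y" "\<beta> m \<in> mspace Y"
      using X Y l m(1) \<open>L' \<subseteq> L\<close> by auto
    have tri: "d x z \<le> d x y + d y z"
      if "x \<in> mspace X <+> mspace Y" "y \<in> mspace X <+> mspace Y" "z \<in> mspace X <+> mspace Y" for x y z
      using d that by (simp add: admissible_def pseudometric_on_def)
    have "ennreal (d (Inl (\<alpha> m)) (Inr (\<beta> m))) \<le> ennreal t"
      using d m(1) by (auto simp: admissible_def SUP_le_iff)
    \<comment> \<open>Since \<open>ennreal\<close> sends negative reals to 0, returning to the reals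
      uses \<open>0 \<le> t\<close>.\<close>
    then have "d (Inl (\<alpha> m)) (Inr (\<beta> m)) \<le> t"
      using \<open>0 \<le> t\<close> by (simp add: ennreal_le_iff)
    moreover have "d (Inl (\<alpha> l)) (Inl (\<alpha> m)) = mdist X (\<alpha> l) (\<alpha> m)"
      "d (Inr (\<beta> m)) (Inr (\<beta> l)) = mdist Y (\<beta> l) (\<beta> m)"
      using d mem by (auto simp: admissible_def mdist_commute)
    moreover have "d (Inl (\<alpha> l)) (Inr (\<beta> l)) \<le> d (Inl (\<alpha> l)) (Inl (\<alpha> m)) + d (Inl (\<alpha> m)) (Inr (\<beta> l))"
      "d (Inl (\<alpha> m)) (Inr (\<beta> l)) \<le> d (Inl (\<alpha> m)) (Inr (\<beta> m)) + d (Inr (\<beta> m)) (Inr (\<beta> l))"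
      using mem by (auto intro!: tri)
    ultimately show ?thesis
      using m by linarith
  qed
  have "ennreal t \<le> ennreal (t + 2 * e)"
    using \<open>0 \<le> e\<close> by (simp add: ennreal_leI)
  then show ?thesis
    using d label by (auto simp: admissible_def SUP_le_iff intro!: ennreal_leI intro: order_trans)
qed

theorem theoremC2:
  fixes L :: "'l set"
    and X :: "'a metric" and \<alpha> :: "'l \<Rightarrow> 'a"
    and Y :: "'b metric" and \<beta> :: "'l \<Rightarrow> 'b"
  assumes "labeled_metric_space L X \<alpha>"
    and "labeled_metric_space L Y \<beta>"
    and "\<And>L'. L' \<subseteq> L \<Longrightarrow> finite L' \<Longrightarrow> LGH_dist L' X \<alpha> Y \<beta> = 0"
    and "closedin (mtopology_of X) (\<alpha> ` L)"
  shows "LGH_dist L X \<alpha> Y \<beta> = 0"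
proof -
  have "LGH_dist L X \<alpha> Y \<beta> \<le> 0 + ennreal e" if e: "0 < e" for e :: real
  proof -
    \<comment> \<open>The two detours, one in each space, cost \<open>e/3\<close> each; the last
      third is left for \<open>t\<close>.\<close>
    obtain L' where L': "finite L'" "L' \<subseteq> L"
      "\<And>l. l \<in> L \<Longrightarrow> \<exists>m\<in>L'. mdist X (\<alpha> l) (\<alpha> m) < e/3 \<and> mdist Y (\<beta> l) (\<beta> m) < e/3"
      using finite_label_net[OF assms(1,2), of "e/3"] e by auto
    have "LGH_dist L' X \<alpha> Y \<beta> < ennreal (e/3)"
      using assms(3)[OF L'(2,1)] e by simp
    \<comment> \<open>The infimum 0 is not known to be attained, so an admissible \<open>t\<close>
      below \<open>e/3\<close> is taken instead.\<close>
    then obtain t d where t: "0 \<le> t" "t < e/3" "admissible t L' X \<alpha> Y \<beta> d"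
      unfolding LGH_dist_def Inf_less_iff by (auto simp: ennreal_less_iff)
    have "admissible (t + 2 * (e/3)) L X \<alpha> Y \<beta> d"
    proof (rule admissible_extend_labels[OF t(3,1) _ _ _ L'(2,3)])
      show "0 \<le> e/3" "\<alpha> \<in> L \<rightarrow> mspace X" "\<beta> \<in> L \<rightarrow> mspace Y"
        using e assms(1,2) by (auto simp: labeled_metric_space_def)
    qed
    then have "LGH_dist L X \<alpha> Y \<beta> \<le> ennreal (t + 2 * (e/3))"
      unfolding LGH_dist_def using t e
      by (intro Inf_lower CollectI exI[of _ "t + 2 * (e/3)"]) auto
    also have "\<dots> \<le> ennreal e"
      using t by (intro ennreal_leI) simp
    finally show ?thesis by simp
  qed
  then have "LGH_dist L X \<alpha> Y \<beta> \<le> 0"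
    by (rule ennreal_le_epsilon)
  then show ?thesis by simp
qed

end
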